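(* Let $\mathbb{S}\subset\mathbb{P}_m(\mathbb{C}^{n\times n})$ be either the set of symmetric or the set of skew-symmetric matrix polynomials, let $P\in\mathbb{S}$ be regular, $\lambda\in\mathbb{C}$ and $\epsilon>0$ (with $\infty$ not in the relevant $\epsilon$-pseudospectra of $P$). (a) For the spectral norm ($M=2$), $\eta_2^{\mathbb{S}}(\lambda,P)=\eta(\lambda,P)$ and $\sigma_\epsilon^{\mathbb{S}}(P)=\sigma_\epsilon(P)$. (b) For the Frobenius norm ($M=F$): if $\mathbb{S}$ is the set of skew-symmetric polynomials, then $\eta_F^{\mathbb{S}}(\lambda,P)=\sqrt2\,\eta(\lambda,P)$ and $\sigma_\epsilon^{\mathbb{S}}(P)=\sigma_{\epsilon/\sqrt2}(P)$; if $\mathbb{S}$ is the set of symmetric polynomials, then $\eta_F^{\mathbb{S}}(\lambda,P)=\eta(\lambda,P)$ and $\sigma_\epsilon^{\mathbb{S}}(P)=\sigma_\epsilon(P)$.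
   Context: $m,n\ge1$ are integers. $\mathbb{P}_m(\mathbb{C}^{n\times n})$ is the vector space of matrix polynomials $P(z)=\sum_{j=0}^m z^jA_j$, $A_j\in\mathbb{C}^{n\times n}$. $P$ is regular if $\det P(z)\not\equiv0$; symmetric (skew-symmetric) if all $A_j^T=A_j$ (resp. $A_j^T=-A_j$). $\sigma(P):=\{z\in\mathbb{C}:\det P(z)=0\}$. For $M\in\{2,F\}$, $|||P|||_M:=\left(\sum_{j=0}^m\|A_j\|_M^2\right)^{1/2}$ with $\|\cdot\|_F$ Frobenius and $\|\cdot\|_2$ spectral norm. For $x\in\mathbb{C}^n$ with $\|x\|_2=1$: $\eta(\lambda,x,P):=\inf\{|||\Delta P|||_M:\Delta P\in\mathbb{P}_m(\mathbb{C}^{n\times n}),\ P(\lambda)x+\Delta P(\lambda)x=0\}=\|P(\lambda)x\|_2/\|[1,\lambda,\ldots,\lambda^m]^T\|_2$ (same for $M=2,F$) and $\eta_M^{\mathbb{S}}(\lambda,x,P):=\inf\{|||\Delta P|||_M:\Delta P\in\mathbb{S},\ P(\lambda)x+\Delta P(\lambda)x=0\}$. Backward errors of $\lambda$: $\eta(\lambda,P):=\min_{\|x\|_2=1}\eta(\lambda,x,P)$, $\eta_M^{\mathbb{S}}(\lambda,P):=\min_{\|x\|_2=1}\eta_M^{\mathbb{S}}(\lambda,x,P)$. Pseudospectra: $\sigma_\epsilon(P):=\bigcup\{\sigma(P+\Delta P):\Delta P\in\mathbb{P}_m(\mathbb{C}^{n\times n}),\ |||\Delta P|||_M\le\epsilon\}$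 (the same set for $M=2,F$) and $\sigma_\epsilon^{\mathbb{S}}(P):=\bigcup\{\sigma(P+\Delta P):\Delta P\in\mathbb{S},\ |||\Delta P|||_M\le\epsilon\}$ with $M$ the norm under consideration. Only finite eigenvalues are considered; the paper assumes throughout, for simplicity, that $\infty\notin\sigma_\epsilon(P)$. *)

theory Defs
  imports "HOL-Analysis.Analysis" "HOL-Computational_Algebra.Polynomial"
begin

text \<open>A matrix polynomial is stored as the coefficient sequence of a polynomial over
  \<open>complex^'n^'n\<close>. The multiplication that the library puts on \<open>complex^'n^'n\<close> is entrywise, but
  only the additive structure and \<open>coeff\<close> of \<open>poly\<close> are used here.\<close>

type_synonym 'n mpoly = "(complex^'n^'n) poly"

definition mat_polys :: "nat \<Rightarrow> 'n::finite mpoly set" where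
  "mat_polys m = {P. degree P \<le> m}"

definition sym_polys :: "nat \<Rightarrow> 'n::finite mpoly set" where
  "sym_polys m = {P \<in> mat_polys m. \<forall>j\<le>m. transpose (coeff P j) = coeff P j}"

definition skew_polys :: "nat \<Rightarrow> 'n::finite mpoly set" where
  "skew_polys m = {P \<in> mat_polys m. \<forall>j\<le>m. transpose (coeff P j) = - coeff P j}"

definition mat_scale :: "complex \<Rightarrow> complex^'n^'n \<Rightarrow> complex^'n^'n" where
  "mat_scale c A = (\<chi> i j. c * A $ i $ j)"

definition mp_eval :: "nat \<Rightarrow> 'n::finite mpoly \<Rightarrow> complex \<Rightarrow> complex^'n^'n" where
  "mp_eval m P z = (\<Sum>j\<le>m. mat_scale (z ^ j) (coeff P j))"

definition regular_mp :: "nat \<Rightarrow> 'n::finite mpoly \<Rightarrow> bool" where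
  "regular_mp m P \<longleftrightarrow> (\<exists>z. det (mp_eval m P z) \<noteq> 0)"

definition spectrum :: "nat \<Rightarrow> 'n::finite mpoly \<Rightarrow> complex set" where
  "spectrum m P = {z. det (mp_eval m P z) = 0}"

definition mp_reversal :: "nat \<Rightarrow> 'n::finite mpoly \<Rightarrow> complex \<Rightarrow> complex^'n^'n" where
  "mp_reversal m P z = (\<Sum>j\<le>m. mat_scale (z ^ (m - j)) (coeff P j))"

text \<open>Infinity is an eigenvalue of \<open>P\<close> iff 0 is an eigenvalue of the reversal \<open>z\<^sup>m P(1/z)\<close>,
  taken with respect to the nominal degree \<open>m\<close>.\<close>

definition infinity_in_spectrum :: "nat \<Rightarrow> 'n::finite mpoly \<Rightarrow> bool" where
  "infinity_in_spectrum m P \<longleftrightarrow> det (mp_reversal m P 0) = 0"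

definition spectral_norm :: "complex^'n^'n \<Rightarrow> real" where
  "spectral_norm A = onorm (\<lambda>x. A *v x)"

definition frobenius_norm :: "complex^'n^'n \<Rightarrow> real" where
  "frobenius_norm A = sqrt (\<Sum>i\<in>UNIV. \<Sum>j\<in>UNIV. (cmod (A $ i $ j))\<^sup>2)"

lemma frobenius_norm_eq_norm: "frobenius_norm A = norm A"
  by (simp add: frobenius_norm_def norm_vec_def L2_set_def sum_nonneg)

text \<open>In what follows \<open>N\<close> is the matrix norm and \<open>S\<close> the set of admissible perturbations;
  \<open>S = mat_polys m\<close> gives the unstructured notions.\<close>

definition mp_norm :: "(complex^'n^'n \<Rightarrow> real) \<Rightarrow> nat \<Rightarrow> 'n::finite mpoly \<Rightarrow> real" where
  "mp_norm N m P = sqrt (\<Sum>j\<le>m. (N (coeff P j))\<^sup>2)"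

definition pair_backward_error ::
  "(complex^'n^'n \<Rightarrow> real) \<Rightarrow> 'n::finite mpoly set \<Rightarrow> nat \<Rightarrow> complex \<Rightarrow> complex^'n \<Rightarrow> 'n mpoly \<Rightarrow> real"
where
  "pair_backward_error N S m lam x P =
     Inf {mp_norm N m D | D. D \<in> S \<and> mp_eval m P lam *v x + mp_eval m D lam *v x = 0}"

text \<open>On the reals \<open>LEAST\<close> is the minimum of the set if it is attained, and unspecified otherwise.\<close>

definition backward_error ::
  "(complex^'n^'n \<Rightarrow> real) \<Rightarrow> 'n::finite mpoly set \<Rightarrow> nat \<Rightarrow> complex \<Rightarrow> 'n mpoly \<Rightarrow> real"
where
  "backward_error N S m lam P =
     (LEAST e. \<exists>x. norm x = 1 \<and> e = pair_backward_error N S m lam x P)"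

definition pseudospectrum ::
  "(complex^'n^'n \<Rightarrow> real) \<Rightarrow> 'n::finite mpoly set \<Rightarrow> nat \<Rightarrow> real \<Rightarrow> 'n mpoly \<Rightarrow> complex set"
where
  "pseudospectrum N S m \<epsilon> P = (\<Union>D \<in> {D \<in> S. mp_norm N m D \<le> \<epsilon>}. spectrum m (P + D))"

definition infinity_in_pseudospectrum ::
  "(complex^'n^'n \<Rightarrow> real) \<Rightarrow> 'n::finite mpoly set \<Rightarrow> nat \<Rightarrow> real \<Rightarrow> 'n mpoly \<Rightarrow> bool"
where
  "infinity_in_pseudospectrum N S m \<epsilon> P \<longleftrightarrow>
     (\<exists>D\<in>S. mp_norm N m D \<le> \<epsilon> \<and> infinity_in_spectrum m (P + D))"

text \<open>The sets over which the infima are taken are nonempty: \<open>- P\<close> is admissible.\<close>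

lemma pair_backward_error_feasible:
  assumes "S = mat_polys m \<or> S = sym_polys m \<or> S = skew_polys m" and "P \<in> S"
  shows "\<exists>D\<in>S. mp_eval m P lam *v x + mp_eval m D lam *v x = 0"
proof (rule bexI[of _ "- P"])
  have tr: "transpose (- A) = - transpose A" for A :: "complex^'n^'n"
    by (simp add: transpose_def vec_eq_iff)
  show "- P \<in> S"
    using assms by (auto simp: mat_polys_def sym_polys_def skew_polys_def tr)
  have "mp_eval m P lam + mp_eval m (- P) lam = 0"
    by (simp add: mp_eval_def mat_scale_def vec_eq_iff sum_negf flip: sum.distrib)
  then show "mp_eval m P lam *v x + mp_eval m (- P) lam *v x = 0"
    by (metis matrix_vector_mult_add_rdistrib matrix_vector_mult_0)
qed

end

theory Submission
  imports Defs
begin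

text \<open>Let \<open>A = P(\<lambda>)\<close>, let \<open>\<sigma>\<close> be its smallest singular value and
  \<open>L\<close> the norm of \<open>(1, \<lambda>, \<dots>, \<lambda>\<^sup>m)\<close>. By Cauchy-Schwarz over the coefficients, and by
  choosing all coefficients of the perturbation proportional to one matrix, backward errors and
  pseudospectra are governed by \<open>c \<sigma> / L\<close>, where \<open>c \<sigma>\<close> is the least norm of a structured matrix
  \<open>M\<close> with \<open>M x = - A x\<close> for some unit \<open>x\<close>. In the symmetric case a Takagi vector,
  \<open>A x = \<sigma> (cnj x)\<close>, allows \<open>M\<close> of rank one, so \<open>c = 1\<close>. In the skew-symmetric case
  \<open>r = - A x\<close> satisfies \<open>r\<^sup>T x = 0\<close> and \<open>M = r x\<^sup>* - (cnj x) r\<^sup>T\<close> is optimal: it has two equal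
  nonzero singular values, which gives \<open>c = 1\<close> for the spectral and \<open>c = sqrt 2\<close> for the Frobenius
  norm.\<close>

section \<open>Complex vectors, rank-one matrices and the bilinear product\<close>

definition vcnj :: "complex^'n \<Rightarrow> complex^'n" where
  "vcnj x = (\<chi> i. cnj (x $ i))"

definition outer :: "complex^'m \<Rightarrow> complex^'n \<Rightarrow> complex^'n^'m" where
  "outer u v = (\<chi> i j. u $ i * v $ j)"

lemma vcnj_vcnj [simp]: "vcnj (vcnj x) = x"
  and vcnj_add: "vcnj (x + y) = vcnj x + vcnj y"
  and vcnj_scaleR: "vcnj (a *\<^sub>R x) = a *\<^sub>R vcnj x"
  and vcnj_smult: "vcnj (c *s x) = cnj c *s vcnj x"
  by (simp_all add: vcnj_def vec_eq_iff)

lemma norm_vcnj [simp]: "norm (vcnj x) = norm x"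
  by (simp add: vcnj_def norm_vec_def)

lemma norm_smult_vec: "norm (c *s x) = cmod c * norm x" for x :: "complex^'n::finite"
  by (simp add: norm_vec_def vector_scalar_mult_def norm_mult L2_set_right_distrib)

lemma scaleR_eq_smult: "a *\<^sub>R x = complex_of_real a *s x"
  unfolding vec_eq_iff vector_scaleR_component vector_smult_component
  by (simp add: scaleR_conv_of_real)

lemma matrix_vector_mult_scaleR': "A *v (a *\<^sub>R x) = a *\<^sub>R (A *v x)" for A :: "complex^'n::finite^'m::finite"
  by (simp add: scaleR_eq_smult vector_scalar_commute)

lemma scalar_product_commute: "scalar_product x y = scalar_product y x"
  for x y :: "complex^'n"
  by (simp add: scalar_product_def mult.commute)

lemma scalar_product_diff_right: "scalar_product x (y - z) = scalar_product x y - scalar_product x z"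
  for x y z :: "complex^'n"
  by (simp add: scalar_product_def algebra_simps sum_subtractf)

lemma scalar_product_uminus_right: "scalar_product x (- y) = - scalar_product x y"
  for x y :: "complex^'n"
  by (simp add: scalar_product_def sum_negf)

lemma scalar_product_smult_right: "scalar_product x (c *s y) = c * scalar_product x y"
  for x y :: "complex^'n"
  by (simp add: scalar_product_def sum_distrib_left mult_ac)

lemma scalar_product_vcnj: "scalar_product (vcnj x) (vcnj y) = cnj (scalar_product x y)"
  by (simp add: scalar_product_def vcnj_def)

lemma scalar_product_matrix: "scalar_product (A *v x) y = scalar_product x (transpose A *v y)"
  for A :: "complex^'n::finite^'m::finite"
  unfolding scalar_product_def matrix_vector_mult_def transpose_def
  by (simp add: sum_distrib_left sum_distrib_right mult_ac) (rule sum.swap)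

text \<open>\<open>scalar_product\<close> does not conjugate, whereas \<open>inner\<close> is the
  real inner product of the underlying real space; this is the passage between the two.\<close>

lemma inner_eq_Re_scalar_product: "inner x y = Re (scalar_product x (vcnj y))"
  by (simp add: inner_vec_def scalar_product_def vcnj_def inner_complex_def)

lemma scalar_product_self: "scalar_product x (vcnj x) = complex_of_real ((norm x)\<^sup>2)"
  for x :: "complex^'n::finite"
  by (simp add: scalar_product_def vcnj_def norm_vec_def L2_set_def sum_nonneg complex_norm_square
      del: of_real_power)

lemma cmod_scalar_product_le: "cmod (scalar_product x y) \<le> norm x * norm y"
  for x y :: "complex^'n::finite"
proof -
  have "cmod (scalar_product x y) \<le> (\<Sum>i\<in>UNIV. \<bar>cmod (x $ i)\<bar> * \<bar>cmod (y $ i)\<bar>)"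
    unfolding scalar_product_def by (rule order_trans[OF norm_sum]) (simp add: norm_mult)
  also have "\<dots> \<le> norm x * norm y"
    unfolding norm_vec_def by (rule L2_set_mult_ineq)
  finally show ?thesis .
qed

lemma norm_matrix_vector_mult_le: "norm (A *v x) \<le> norm A * norm x"
  for A :: "complex^'n::finite^'m::finite"
proof -
  have "norm (A *v x) \<le> L2_set (\<lambda>i. norm (A $ i) * norm x) UNIV"
    unfolding norm_vec_def[of "A *v x"]
  proof (rule L2_set_mono)
    show "norm ((A *v x) $ i) \<le> norm (A $ i) * norm x" for i
      using cmod_scalar_product_le[of "A $ i" x]
      by (simp add: scalar_product_def matrix_vector_mult_def)
  qed simp
  also have "\<dots> = norm A * norm x"
    by (simp add: norm_vec_def[of A] L2_set_left_distrib)
  finally show ?thesis .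
qed

lemma norm_outer: "norm (outer u v) = norm u * norm v"
  for u :: "complex^'m::finite" and v :: "complex^'n::finite"
proof -
  have "outer u v $ i = (u $ i) *s v" for i
    by (simp add: outer_def vec_eq_iff)
  then have "norm (outer u v) = L2_set (\<lambda>i. cmod (u $ i) * norm v) UNIV"
    by (simp add: norm_vec_def[of "outer u v"] norm_smult_vec)
  then show ?thesis
    by (simp add: norm_vec_def[of u] L2_set_left_distrib)
qed

lemma outer_mult_vec: "outer u v *v x = scalar_product v x *s u"
  by (simp add: outer_def matrix_vector_mult_def scalar_product_def vec_eq_iff sum_distrib_left
      sum_distrib_right mult_ac)

lemma transpose_outer: "transpose (outer u v) = outer v u"
  by (simp add: outer_def transpose_def vec_eq_iff mult.commute)

lemma transpose_diff: "transpose (A - B) = transpose A - transpose B"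
  by (simp add: transpose_def vec_eq_iff)

lemma uminus_matrix_vector_mult: "(- A) *v x = - (A *v x)" for A :: "complex^'n^'m"
  by (simp add: matrix_vector_mult_def vec_eq_iff sum_negf)

text \<open>Pairing with a rank-one matrix in the real Frobenius inner product reduces to vectors.
  This serves both the orthogonality and the Cauchy-Schwarz computation for
  \<open>skew_map\<close>.\<close>

lemma inner_outer: "inner A (outer u v) = inner (A *v vcnj v) u"
  for A :: "complex^'n::finite^'m::finite"
proof -
  have "inner (A $ i) (outer u v $ i) = inner ((A *v vcnj v) $ i) (u $ i)" for i
  proof -
    have "inner (a * cnj b) c = inner a (c * b)" for a b c :: complex
      by (simp add: inner_complex_def algebra_simps)
    then show ?thesis
      by (simp add: inner_vec_def outer_def matrix_vector_mult_def vcnj_def inner_sum_left)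
  qed
  then show ?thesis
    by (simp add: inner_vec_def[of A] inner_vec_def[of "A *v vcnj v"])
qed

section \<open>Spectral and Frobenius norms of matrices\<close>

lemma spectral_norm_bound: "norm (A *v x) \<le> spectral_norm A * norm x"
  for A :: "complex^'n::finite^'n"
proof -
  have "bounded_linear (\<lambda>x. A *v x)"
    by (rule bounded_linear_intro[where K = "norm A"])
      (simp_all add: matrix_vector_right_distrib matrix_vector_mult_scaleR'
        norm_matrix_vector_mult_le mult.commute[of "norm _" "norm A"])
  then show ?thesis
    unfolding spectral_norm_def by (rule onorm)
qed

lemma spectral_norm_le: "(\<And>x. norm (A *v x) \<le> b * norm x) \<Longrightarrow> spectral_norm A \<le> b"
  unfolding spectral_norm_def by (rule onorm_le)

lemma spectral_norm_le_frobenius: "spectral_norm A \<le> frobenius_norm A"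
  by (simp add: spectral_norm_le norm_matrix_vector_mult_le frobenius_norm_eq_norm)

lemma frobenius_norm_bound: "norm (A *v x) \<le> frobenius_norm A * norm x"
  by (simp add: norm_matrix_vector_mult_le frobenius_norm_eq_norm)

section \<open>Skew-symmetric matrices and the optimal skew perturbation\<close>

text \<open>Moving \<open>A\<close> across the bilinear product turns the value into its own
  negative. Hence \<open>r = - A x\<close> satisfies the orthogonality assumed for
  \<open>skew_map r x\<close>.\<close>

lemma skew_scalar_product:
  fixes A :: "complex^'n::finite^'n"
  assumes "transpose A = - A"
  shows "scalar_product (A *v x) x = 0"
proof -
  have "scalar_product (A *v x) x = - scalar_product x (A *v x)"
    by (simp add: scalar_product_matrix assms uminus_matrix_vector_mult
        scalar_product_uminus_right del: transpose_matrix_vector)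
  then show ?thesis
    using scalar_product_commute[of x "A *v x"] by simp
qed

definition skew_map :: "complex^'n \<Rightarrow> complex^'n \<Rightarrow> complex^'n^'n" where
  "skew_map r x = outer r (vcnj x) - outer (vcnj x) r"

lemma transpose_skew_map: "transpose (skew_map r x) = - skew_map r x"
  by (simp add: skew_map_def transpose_diff transpose_outer)

lemma skew_map_mult_vec:
  "skew_map r x *v v = scalar_product (vcnj x) v *s r - scalar_product r v *s vcnj x"
  for v :: "complex^'n::finite"
  by (simp add: skew_map_def outer_mult_vec matrix_vector_mult_diff_rdistrib)

context
  fixes r x :: "complex^'n::finite"
  assumes x: "norm x = 1" and r: "scalar_product r x = 0"
begin

lemma skew_map_apply: "skew_map r x *v x = r"
  using scalar_product_self[of x] r x
  by (simp add: skew_map_mult_vec scalar_product_commute)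

text \<open>The two rank-one terms are orthogonal because \<open>scalar_product r x = 0\<close>, and
  each has Frobenius norm \<open>norm r\<close>.\<close>

lemma norm_skew_map: "norm (skew_map r x) = sqrt 2 * norm r"
proof -
  have "inner (outer r (vcnj x)) (outer (vcnj x) r) = 0"
    using r by (simp add: inner_outer outer_mult_vec scalar_product_vcnj scalar_product_commute)
  then have "(norm (skew_map r x))\<^sup>2 = 2 * (norm r)\<^sup>2"
    by (simp add: skew_map_def power2_norm_eq_inner inner_diff inner_commute)
      (simp add: power2_norm_eq_inner[symmetric] norm_outer x)
  then show ?thesis
    by (metis norm_ge_zero real_sqrt_mult real_sqrt_unique abs_norm_cancel real_sqrt_abs)
qed

text \<open>The range of \<open>skew_map r x\<close> is spanned by the orthogonal vectors \<open>r\<close> and \<open>vcnj x\<close>, so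
  Pythagoras reduces the bound to Bessel's inequality for \<open>x\<close> and \<open>vcnj r\<close>.\<close>

lemma norm_skew_map_mult_vec: "norm (skew_map r x *v v) \<le> norm r * norm v"
proof -
  define \<alpha> where "\<alpha> = scalar_product (vcnj x) v"
  \<comment> \<open>\<open>w\<close> is the part of \<open>v\<close> orthogonal to \<open>x\<close>
    in the Hermitian sense. Since \<open>scalar_product r x = 0\<close>, only \<open>w\<close>
    contributes to \<open>scalar_product r v\<close>.\<close>
  define w where "w = v - \<alpha> *s x"
  have norm_v: "(norm v)\<^sup>2 = (cmod \<alpha>)\<^sup>2 + (norm w)\<^sup>2"
  proof -
    have "scalar_product (vcnj x) w = 0"
      using scalar_product_self[of x] x
      by (simp add: w_def \<alpha>_def scalar_product_diff_right scalar_product_smult_right scalar_product_commute)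
    then have "inner w (\<alpha> *s x) = 0"
      by (simp add: inner_eq_Re_scalar_product vcnj_smult scalar_product_smult_right
          scalar_product_commute[of w])
    moreover have "v = w + \<alpha> *s x"
      by (simp add: w_def)
    ultimately show ?thesis
      using dot_norm[of w "\<alpha> *s x"] x by (simp add: norm_smult_vec)
  qed
  have "scalar_product r v = scalar_product r w"
    using r by (simp add: w_def scalar_product_diff_right scalar_product_smult_right)
  then have "cmod (scalar_product r v) \<le> norm r * norm w"
    by (simp add: cmod_scalar_product_le)
  moreover have "inner (\<alpha> *s r) (scalar_product r v *s vcnj x) = 0"
    using r by (simp add: inner_eq_Re_scalar_product vcnj_smult scalar_product_smult_right
        scalar_product_commute[of "_ *s _"] scalar_product_commute[of x])
  then have "(norm (skew_map r x *v v))\<^sup>2 = (cmod \<alpha> * norm r)\<^sup>2 + (cmod (scalar_product r v))\<^sup>2"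
    using dot_norm_neg[of "\<alpha> *s r" "scalar_product r v *s vcnj x"] x
    by (simp add: skew_map_mult_vec \<alpha>_def norm_smult_vec)
  ultimately have "(norm (skew_map r x *v v))\<^sup>2 \<le> (cmod \<alpha> * norm r)\<^sup>2 + (norm r * norm w)\<^sup>2"
    by (simp add: power_mono)
  also have "\<dots> = (norm r * norm v)\<^sup>2"
    by (simp add: norm_v power_mult_distrib algebra_simps)
  finally show ?thesis
    by (rule power2_le_imp_le) simp
qed

end

text \<open>Cauchy-Schwarz for \<open>A\<close> and \<open>skew_map (A *v x) x\<close>.\<close>

lemma skew_frobenius_norm_bound:
  fixes A :: "complex^'n::finite^'n"
  assumes A: "transpose A = - A" and x: "norm x = 1"
  shows "sqrt 2 * norm (A *v x) \<le> frobenius_norm A"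
proof (cases "A *v x = 0")
  case True
  then show ?thesis by (simp add: frobenius_norm_eq_norm)
next
  case False
  define r where "r = A *v x"
  have r: "scalar_product r x = 0"
    unfolding r_def by (rule skew_scalar_product[OF A])
  \<comment> \<open>Skew-symmetry makes the second rank-one term of \<open>skew_map r x\<close>
    contribute as much as the first, so the pairing with \<open>A\<close> is twice
    \<open>(norm r)^2\<close>.\<close>
  have "inner (A *v vcnj r) (vcnj x) = Re (scalar_product (A *v vcnj r) x)"
    by (simp add: inner_eq_Re_scalar_product)
  also have "\<dots> = Re (scalar_product (vcnj r) (- r))"
    by (simp add: scalar_product_matrix A uminus_matrix_vector_mult r_def del: transpose_matrix_vector)
  also have "\<dots> = - inner r r"
    by (simp add: inner_eq_Re_scalar_product scalar_product_commute)
      (simp add: scalar_product_def sum_negf mult.commute)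
  finally have "inner A (skew_map r x) = 2 * (norm r)\<^sup>2"
    by (simp add: skew_map_def inner_diff_right inner_outer r_def power2_norm_eq_inner)
  then have "2 * (norm r)\<^sup>2 \<le> norm A * (sqrt 2 * norm r)"
    using norm_cauchy_schwarz[of A "skew_map r x"] by (simp add: norm_skew_map[OF x r])
  then have "(sqrt 2 * norm r) * (sqrt 2 * norm r) \<le> norm A * (sqrt 2 * norm r)"
    by (simp only: power2_eq_square[symmetric] power_mult_distrib) simp
  moreover have "0 < sqrt 2 * norm r"
    using False by (simp add: r_def)
  ultimately have "sqrt 2 * norm r \<le> norm A"
    by (rule mult_right_le_imp_le)
  then show ?thesis
    by (simp add: r_def frobenius_norm_eq_norm)
qed

section \<open>Symmetric matrices and Takagi vectors\<close>

text \<open>Takagi's argument: for the conjugate-linear, real self-adjoint map \<open>T v = vcnj (A *v v)\<close> one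
  has \<open>T\<^sup>2 x = \<sigma>\<^sup>2 x\<close> at a minimizer \<open>x\<close>, so \<open>T x + \<sigma> x\<close>, or \<open>\<i> x\<close> if this vanishes,
  is a nonzero solution of \<open>T z = \<sigma> z\<close>.\<close>

lemma takagi_min_vector:
  fixes A :: "complex^'n::finite^'n"
  assumes A: "transpose A = A" and x: "norm x = 1"
    and min: "\<And>y. norm y = 1 \<Longrightarrow> norm (A *v x) \<le> norm (A *v y)"
  obtains y where "norm y = 1" "A *v y = complex_of_real (norm (A *v x)) *s vcnj y"
proof -
  define \<sigma> where "\<sigma> = norm (A *v x)"
  define T where "T v = vcnj (A *v v)" for v
  have T_add: "T (u + v) = T u + T v" and T_scaleR: "T (a *\<^sub>R v) = a *\<^sub>R T v" for u v a
    by (simp_all add: T_def matrix_vector_right_distrib vcnj_add matrix_vector_mult_scaleR' vcnj_scaleR)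
  \<comment> \<open>\<open>vcnj\<close> conjugates a scalar product of which \<open>inner\<close>
    sees only the real part, so the symmetry of \<open>A\<close> suffices.\<close>
  have T_self_adjoint: "inner (T u) v = inner u (T v)" for u v
  proof -
    have "inner (T u) v = Re (cnj (scalar_product (A *v u) v))"
      by (simp add: inner_eq_Re_scalar_product T_def scalar_product_vcnj)
    also have "\<dots> = Re (scalar_product u (A *v v))"
      by (simp add: scalar_product_matrix A del: transpose_matrix_vector)
    finally show ?thesis
      by (simp add: inner_eq_Re_scalar_product T_def)
  qed
  have lower: "\<sigma> * norm v \<le> norm (T v)" for v
  proof (cases "v = 0")
    case False
    then have "\<sigma> \<le> norm (A *v ((1 / norm v) *\<^sub>R v))"
      unfolding \<sigma>_def by (intro min) simp
    then show ?thesis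
      using False by (simp add: matrix_vector_mult_scaleR' T_def field_simps)
  qed simp
  \<comment> \<open>Half the gradient at \<open>x\<close> of
    \<open>(norm (T v))^2 - \<sigma>^2 * (norm v)^2\<close>, a nonnegative function of
    \<open>v\<close> that vanishes at \<open>x\<close>.\<close>
  define g where "g = T (T x) - \<sigma>\<^sup>2 *\<^sub>R x"
  \<comment> \<open>That function is expanded at \<open>x + t v\<close>, and its nonpositive term
    \<open>- \<sigma>^2 * t^2 * inner v v\<close> is discarded.\<close>
  have variation: "0 \<le> 2 * t * inner g v + t\<^sup>2 * inner (T v) (T v)" for t v
  proof -
    have "(\<sigma> * norm (x + t *\<^sub>R v))\<^sup>2 \<le> (norm (T (x + t *\<^sub>R v)))\<^sup>2"
      by (intro power_mono lower) (simp add: \<sigma>_def)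
    moreover have "(norm (T (x + t *\<^sub>R v)))\<^sup>2 = \<sigma>\<^sup>2 + 2 * t * inner (T (T x)) v + t\<^sup>2 * inner (T v) (T v)"
    proof -
      have "inner (T x) (T x) = \<sigma>\<^sup>2"
        by (simp add: power2_norm_eq_inner[symmetric] T_def \<sigma>_def)
      moreover have "inner (T (T x)) v = inner (T x) (T v)"
        by (rule T_self_adjoint)
      ultimately show ?thesis
        unfolding power2_norm_eq_inner T_add T_scaleR
        by (simp add: inner_add inner_commute[of "T v" "T x"] power2_eq_square algebra_simps)
    qed
    moreover have "(\<sigma> * norm (x + t *\<^sub>R v))\<^sup>2 = \<sigma>\<^sup>2 * (1 + 2 * t * inner x v + t\<^sup>2 * inner v v)"
    proof -
      have "inner x x = 1"
        using x by (simp add: power2_norm_eq_inner[symmetric])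
      then show ?thesis
        unfolding power_mult_distrib power2_norm_eq_inner
        by (simp add: inner_add inner_commute[of v x] power2_eq_square algebra_simps)
    qed
    moreover have "\<sigma>\<^sup>2 * (1 + 2 * t * inner x v) \<le> \<sigma>\<^sup>2 * (1 + 2 * t * inner x v + t\<^sup>2 * inner v v)"
      by (intro mult_left_mono) simp_all
    ultimately have "\<sigma>\<^sup>2 * (1 + 2 * t * inner x v)
        \<le> \<sigma>\<^sup>2 + 2 * t * inner (T (T x)) v + t\<^sup>2 * inner (T v) (T v)"
      by linarith
    then show ?thesis
      by (simp add: g_def inner_diff_left algebra_simps)
  qed
  have "g = 0"
  proof (rule ccontr)
    assume "g \<noteq> 0"
    define b where "b = inner (T g) (T g)"
    \<comment> \<open>A descent step along \<open>- g\<close>: the denominator \<open>1 + b\<close>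
      keeps \<open>t\<close> positive and gives \<open>t * b \<le> inner g g\<close>, too small for
      the variation inequality at \<open>- t\<close>.\<close>
    define t where "t = inner g g / (1 + b)"
    have pos: "inner g g > 0" and b: "b \<ge> 0"
      using \<open>g \<noteq> 0\<close> by (simp_all add: b_def)
    have t: "t > 0" using pos b by (simp add: t_def)
    have "0 \<le> t * (t * b - 2 * inner g g)"
      using variation[of "- t" g] by (simp add: b_def power2_eq_square algebra_simps)
    then have "2 * inner g g \<le> t * b"
      using t by (simp add: zero_le_mult_iff)
    also have "t * b \<le> inner g g"
      using pos b by (simp add: t_def field_simps)
    finally show False using pos by simp
  qed
  then have TT: "T (T x) = \<sigma>\<^sup>2 *\<^sub>R x"
    by (simp add: g_def)
  have "\<exists>z. z \<noteq> 0 \<and> T z = \<sigma> *\<^sub>R z"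
  proof (cases "T x + \<sigma> *\<^sub>R x = 0")
    case False
    \<comment> \<open>This is the factorization
      \<open>(T - \<sigma>) (T + \<sigma>) x = 0\<close>.\<close>
    moreover have "T (T x + \<sigma> *\<^sub>R x) = \<sigma> *\<^sub>R (T x + \<sigma> *\<^sub>R x)"
      by (simp add: T_add T_scaleR TT power2_eq_square scaleR_add_right)
    ultimately show ?thesis by blast
  next
    case True
    \<comment> \<open>\<open>T\<close> is conjugate-linear, so multiplication by \<open>\<i>\<close>
      turns the eigenvalue \<open>- \<sigma>\<close> of \<open>x\<close> into
      \<open>\<sigma>\<close>.\<close>
    have "T (\<i> *s x) = - \<i> *s T x"
      by (simp add: T_def vector_scalar_commute vcnj_smult)
    also have "\<dots> = - \<i> *s (- (\<sigma> *\<^sub>R x))"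
      using True by (metis eq_neg_iff_add_eq_0)
    also have "\<dots> = \<sigma> *\<^sub>R (\<i> *s x)"
      by (simp add: vec_eq_iff)
    finally have "T (\<i> *s x) = \<sigma> *\<^sub>R (\<i> *s x)" .
    moreover have "\<i> *s x \<noteq> 0"
      using x by (metis norm_smult_vec norm_ii mult_1 norm_zero zero_neq_one)
    ultimately show ?thesis by blast
  qed
  then obtain z where "z \<noteq> 0" and z: "T z = \<sigma> *\<^sub>R z" by blast
  define y where "y = (1 / norm z) *\<^sub>R z"
  have "T y = \<sigma> *\<^sub>R y"
    by (simp add: y_def T_scaleR z)
  then have "A *v y = \<sigma> *\<^sub>R vcnj y"
    unfolding T_def by (metis vcnj_vcnj vcnj_scaleR)
  moreover have "norm y = 1"
    using \<open>z \<noteq> 0\<close> by (simp add: y_def)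
  ultimately show thesis
    using that by (simp add: scaleR_eq_smult \<sigma>_def)
qed

section \<open>Structured matrix polynomials and their evaluation\<close>

text \<open>A coefficient set \<open>K\<close> describes all three perturbation classes at once; the
  construction of perturbations only asks that \<open>K\<close> be closed under scaling.\<close>

definition mp_class :: "nat \<Rightarrow> (complex^'n^'n) set \<Rightarrow> 'n::finite mpoly set" where
  "mp_class m K = {P \<in> mat_polys m. \<forall>j\<le>m. coeff P j \<in> K}"

definition pow_norm :: "nat \<Rightarrow> complex \<Rightarrow> real" where
  "pow_norm m z = L2_set (\<lambda>j. cmod (z ^ j)) {..m}"

lemma mat_polys_eq_class: "mat_polys m = mp_class m UNIV"
  and sym_polys_eq_class: "sym_polys m = mp_class m {A. transpose A = A}"
  and skew_polys_eq_class: "skew_polys m = mp_class m {A. transpose A = - A}"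
  by (auto simp: mp_class_def sym_polys_def skew_polys_def)

lemma pow_norm_pos: "0 < pow_norm m z"
proof -
  have "cmod (z ^ 0) \<le> pow_norm m z"
    unfolding pow_norm_def by (rule member_le_L2_set) simp_all
  then show ?thesis by simp
qed

lemma sum_pow_norm: "(\<Sum>j\<le>m. (cmod z ^ j)\<^sup>2) = (pow_norm m z)\<^sup>2"
  by (simp add: pow_norm_def L2_set_def sum_nonneg norm_power)

lemma mat_scale_mult_vec: "mat_scale c A *v x = c *s (A *v x)"
  by (simp add: mat_scale_def matrix_vector_mult_def vec_eq_iff sum_distrib_left mult.assoc)

lemma transpose_mat_scale: "transpose (mat_scale c A) = mat_scale c (transpose A)"
  and mat_scale_uminus: "mat_scale c (- A) = - mat_scale c A"
  and mat_scale_mat_scale: "mat_scale c (mat_scale d A) = mat_scale (c * d) A"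
  by (simp_all add: mat_scale_def transpose_def vec_eq_iff)

lemma frobenius_norm_mat_scale: "frobenius_norm (mat_scale c A) = cmod c * frobenius_norm A"
proof -
  have "mat_scale c A $ i = c *s (A $ i)" for i
    by (simp add: mat_scale_def vec_eq_iff)
  then show ?thesis
    by (simp add: frobenius_norm_eq_norm norm_vec_def[of "mat_scale c A"] norm_vec_def[of A]
        norm_smult_vec L2_set_right_distrib)
qed

lemma spectral_norm_mat_scale_le: "spectral_norm (mat_scale c A) \<le> cmod c * spectral_norm A"
  by (rule spectral_norm_le)
    (simp add: mat_scale_mult_vec norm_smult_vec mult.assoc mult_left_mono spectral_norm_bound)

lemma mp_eval_add: "mp_eval m (P + D) z = mp_eval m P z + mp_eval m D z"
  by (simp add: mp_eval_def mat_scale_def vec_eq_iff distrib_left flip: sum.distrib)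

lemma mp_eval_mult_vec: "mp_eval m P z *v x = (\<Sum>j\<le>m. z ^ j *s (coeff P j *v x))"
proof -
  have "(\<Sum>j\<in>J. B j) *v x = (\<Sum>j\<in>J. B j *v x)" if "finite J" for J and B :: "nat \<Rightarrow> complex^'a^'a"
    using that by induction (simp_all add: matrix_vector_mult_add_rdistrib)
  then show ?thesis
    by (simp add: mp_eval_def mat_scale_mult_vec)
qed

lemma transpose_mp_eval:
  "transpose (mp_eval m P z) = (\<Sum>j\<le>m. mat_scale (z ^ j) (transpose (coeff P j)))"
  by (simp add: mp_eval_def transpose_def mat_scale_def vec_eq_iff)

lemma transpose_mp_eval_sym: "P \<in> sym_polys m \<Longrightarrow> transpose (mp_eval m P z) = mp_eval m P z"
  unfolding transpose_mp_eval by (simp add: sym_polys_def mp_eval_def)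

lemma transpose_mp_eval_skew: "P \<in> skew_polys m \<Longrightarrow> transpose (mp_eval m P z) = - mp_eval m P z"
  unfolding transpose_mp_eval by (simp add: skew_polys_def mp_eval_def mat_scale_uminus sum_negf)

text \<open>Triangle inequality, then Cauchy-Schwarz over the index \<open>j\<close>. The factor
  \<open>c\<close> carries the gain \<open>sqrt 2\<close> that skew-symmetry brings for the
  Frobenius norm.\<close>

lemma mp_eval_lower_bound:
  assumes "\<And>j. j \<le> m \<Longrightarrow> c * norm (coeff D j *v x) \<le> N (coeff D j)" and "c \<ge> 0"
  shows "c * norm (mp_eval m D z *v x) \<le> pow_norm m z * mp_norm N m D"
proof -
  have "c * norm (mp_eval m D z *v x) \<le> c * (\<Sum>j\<le>m. norm (z ^ j *s (coeff D j *v x)))"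
    unfolding mp_eval_mult_vec by (intro mult_left_mono norm_sum \<open>c \<ge> 0\<close>)
  also have "\<dots> = (\<Sum>j\<le>m. cmod (z ^ j) * (c * norm (coeff D j *v x)))"
    by (simp add: norm_smult_vec sum_distrib_left mult_ac)
  also have "\<dots> \<le> (\<Sum>j\<le>m. \<bar>cmod (z ^ j)\<bar> * \<bar>N (coeff D j)\<bar>)"
    by (intro sum_mono mult_mono) (use assms in \<open>auto intro: order_trans[OF _ abs_ge_self]\<close>)
  also have "\<dots> \<le> pow_norm m z * mp_norm N m D"
    unfolding pow_norm_def mp_norm_def L2_set_def[symmetric] by (rule L2_set_mult_ineq)
  finally show ?thesis .
qed

text \<open>The coefficients of the minimal interpolating perturbation are multiples of a single matrix
  with the weights of the minimum-norm solution of \<open>\<Sum>j\<le>m. a j * z ^ j = 1\<close>.\<close>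

lemma minimal_perturbation:
  fixes M :: "complex^'n::finite^'n"
  assumes "M \<in> K" and K: "\<And>c A. A \<in> K \<Longrightarrow> mat_scale c A \<in> K"
    and N: "\<And>c A. N (mat_scale c A) \<le> cmod c * N A" "\<And>A. 0 \<le> N A"
  obtains D where "D \<in> mp_class m K" "mp_eval m D z = M" "mp_norm N m D \<le> N M / pow_norm m z"
proof
  let ?L = "pow_norm m z"
  define a where "a j = cnj (z ^ j) / complex_of_real (?L\<^sup>2)" for j
  define D where "D = (\<Sum>j\<le>m. monom (mat_scale (a j) M) j)"
  have coeff_D: "coeff D j = (if j \<le> m then mat_scale (a j) M else 0)" for j
    by (simp add: D_def coeff_sum)
  have "degree D \<le> m"
    by (rule degree_le) (simp add: coeff_D)
  then show "D \<in> mp_class m K"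
    by (simp add: mp_class_def mat_polys_def coeff_D K \<open>M \<in> K\<close>)
  have norm_a: "cmod (a j) = cmod z ^ j / ?L\<^sup>2" for j
    by (simp add: a_def norm_divide norm_power)
  have "mp_norm N m D \<le> sqrt (\<Sum>j\<le>m. (cmod (a j) * N M)\<^sup>2)"
    unfolding mp_norm_def
    by (intro real_sqrt_le_mono sum_mono power_mono N) (simp add: coeff_D N)
  also have "(\<Sum>j\<le>m. (cmod (a j) * N M)\<^sup>2) = (\<Sum>j\<le>m. (cmod z ^ j)\<^sup>2) * (N M / ?L\<^sup>2)\<^sup>2"
    by (simp add: norm_a sum_distrib_right power_mult_distrib power_divide sum_divide_distrib)
  also have "\<dots> = (N M / ?L)\<^sup>2"
    using pow_norm_pos[of m z] unfolding sum_pow_norm by (simp add: power_divide power2_eq_square)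
  finally show "mp_norm N m D \<le> N M / ?L"
    using N(2)[of M] pow_norm_pos[of m z] by simp
  have "z ^ j * cnj (z ^ j) = complex_of_real ((cmod z ^ j)\<^sup>2)" for j
    by (simp only: complex_norm_square[symmetric] norm_power)
  then have "(\<Sum>j\<le>m. z ^ j * a j) = (\<Sum>j\<le>m. complex_of_real ((cmod z ^ j)\<^sup>2)) / complex_of_real (?L\<^sup>2)"
    by (simp only: a_def sum_divide_distrib times_divide_eq_right)
  also have "\<dots> = 1"
    using pow_norm_pos[of m z] by (simp only: of_real_sum[symmetric] sum_pow_norm) simp
  finally have "(\<Sum>j\<le>m. z ^ j * a j) = 1" .
  then have "(\<Sum>j\<le>m. mat_scale (z ^ j * a j) M) = M"
    by (simp add: mat_scale_def vec_eq_iff flip: sum_distrib_right)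
  then show "mp_eval m D z = M"
    by (simp add: mp_eval_def coeff_D mat_scale_mat_scale)
qed

text \<open>A kernel vector can be normalized. This translates membership in the spectrum into the
  unit vectors over which backward errors are minimized.\<close>

lemma det_eq_0_iff_unit_kernel: "det A = 0 \<longleftrightarrow> (\<exists>x. norm x = 1 \<and> A *v x = 0)"
  for A :: "complex^'n::finite^'n"
proof -
  have "det A = 0 \<longleftrightarrow> (\<exists>x. x \<noteq> 0 \<and> A *v x = 0)"
    using matrix_left_invertible_ker[of A] invertible_det_nz[of A] matrix_left_right_inverse[of _ A]
    unfolding invertible_def by metis
  also have "\<dots> \<longleftrightarrow> (\<exists>x. norm x = 1 \<and> A *v x = 0)"
  proof
    assume "\<exists>x. x \<noteq> 0 \<and> A *v x = 0"
    then obtain x where "x \<noteq> 0" "A *v x = 0" by blast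
    then have "norm ((1 / norm x) *\<^sub>R x) = 1 \<and> A *v ((1 / norm x) *\<^sub>R x) = 0"
      by (simp add: matrix_vector_mult_scaleR')
    then show "\<exists>x. norm x = 1 \<and> A *v x = 0" by blast
  next
    assume "\<exists>x. norm x = 1 \<and> A *v x = 0"
    then show "\<exists>x. x \<noteq> 0 \<and> A *v x = 0"
      by (metis norm_zero zero_neq_one)
  qed
  finally show ?thesis .
qed

section \<open>The smallest singular value and the distance formula\<close>

text \<open>The smallest singular value of \<open>A\<close> in variational form.\<close>

definition min_gain :: "complex^'n::finite^'n \<Rightarrow> real" where
  "min_gain A = Inf {norm (A *v x) | x. norm x = 1}"

text \<open>Compactness of the unit sphere; a coordinate vector shows that it is nonempty.\<close>

lemma min_gain_attained:
  fixes A :: "complex^'n::finite^'n"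
  obtains x where "norm x = 1" "norm (A *v x) = min_gain A"
    "\<And>y. norm y = 1 \<Longrightarrow> norm (A *v x) \<le> norm (A *v y)"
proof -
  have "continuous_on (sphere 0 1) (\<lambda>x. norm (A *v x))"
    unfolding matrix_vector_mult_def by (intro continuous_intros)
  moreover have "axis undefined 1 \<in> (sphere 0 1 :: (complex^'n) set)"
    by (simp add: norm_axis_1)
  ultimately obtain x where "x \<in> sphere 0 1" "\<forall>y\<in>sphere 0 1. norm (A *v x) \<le> norm (A *v y)"
    using continuous_attains_inf[OF compact_sphere] by blast
  then have x: "norm x = 1" "\<And>y. norm y = 1 \<Longrightarrow> norm (A *v x) \<le> norm (A *v y)"
    by simp_all
  then have "min_gain A = norm (A *v x)"
    unfolding min_gain_def by (intro cInf_eq_minimum) auto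
  then show thesis using that x by simp
qed

lemma min_gain_le: "norm x = 1 \<Longrightarrow> min_gain A \<le> norm (A *v x)"
  using min_gain_attained[of A] by metis

text \<open>The interplay of structure and norm enters through \<open>lower\<close>, valid for every
  matrix in \<open>K\<close>, and \<open>upper\<close>, which supplies one optimal matrix. Together
  they make the value \<open>?e\<close> an attained minimum over all unit vectors and admissible
  perturbations, from which both claims follow.\<close>

lemma backward_error_and_pseudospectrum:
  fixes P :: "'n::finite mpoly"
  assumes S: "S = mp_class m K" "S = mat_polys m \<or> S = sym_polys m \<or> S = skew_polys m"
    and "P \<in> S" and "c \<ge> 0"
    and K: "\<And>d A. A \<in> K \<Longrightarrow> mat_scale d A \<in> K"
    and N: "\<And>d A. N (mat_scale d A) \<le> cmod d * N A" "\<And>A. 0 \<le> N A"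
    and lower: "\<And>A x. A \<in> K \<Longrightarrow> norm x = 1 \<Longrightarrow> c * norm (A *v x) \<le> N A"
    and upper: "\<exists>x. \<exists>M\<in>K. norm x = 1 \<and> M *v x = - (mp_eval m P z *v x)
                  \<and> N M \<le> c * min_gain (mp_eval m P z)"
  shows "backward_error N S m z P = c * min_gain (mp_eval m P z) / pow_norm m z"
    and "z \<in> pseudospectrum N S m \<epsilon> P \<longleftrightarrow> c * min_gain (mp_eval m P z) / pow_norm m z \<le> \<epsilon>"
proof -
  let ?A = "mp_eval m P z"
  let ?e = "c * min_gain ?A / pow_norm m z"
  have ge: "?e \<le> mp_norm N m D"
    if "norm x = 1" "D \<in> S" "?A *v x + mp_eval m D z *v x = 0" for x D
  proof -
    have "c * min_gain ?A \<le> c * norm (?A *v x)"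
      by (intro mult_left_mono min_gain_le that \<open>c \<ge> 0\<close>)
    also have "norm (?A *v x) = norm (mp_eval m D z *v x)"
      using that(3) by (metis add_eq_0_iff norm_minus_cancel)
    also have "c * \<dots> \<le> pow_norm m z * mp_norm N m D"
      by (rule mp_eval_lower_bound) (use that S \<open>c \<ge> 0\<close> in \<open>auto simp: mp_class_def intro: lower\<close>)
    finally show ?thesis
      using pow_norm_pos[of m z] by (simp add: divide_le_eq mult.commute)
  qed
  obtain x0 D0 where x0: "norm x0 = 1" and D0: "D0 \<in> S" "?A *v x0 + mp_eval m D0 z *v x0 = 0"
    and D0_norm: "mp_norm N m D0 = ?e"
  proof -
    obtain x M where "norm x = 1" "M \<in> K" and M: "M *v x = - (?A *v x)" "N M \<le> c * min_gain ?A"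
      using upper by blast
    moreover obtain D where D: "D \<in> S" "mp_eval m D z = M" "mp_norm N m D \<le> N M / pow_norm m z"
      using minimal_perturbation[OF \<open>M \<in> K\<close> K N] S by metis
    moreover have "N M / pow_norm m z \<le> ?e"
      using M(2) pow_norm_pos[of m z] by (simp add: divide_right_mono)
    ultimately show thesis
      using that[of x D] ge[of x D] by simp
  qed
  have pair_ge: "?e \<le> pair_backward_error N S m z x P" if "norm x = 1" for x
    unfolding pair_backward_error_def
    by (rule cInf_greatest)
      (use pair_backward_error_feasible[OF S(2) \<open>P \<in> S\<close>, of z x] ge that in auto)
  have "pair_backward_error N S m z x0 P = ?e"
    unfolding pair_backward_error_def
    by (rule cInf_eq_minimum) (use x0 D0 D0_norm[symmetric] ge in auto)
  \<comment> \<open>The value is attained at \<open>x0\<close>, so \<open>LEAST\<close> is a genuine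
    minimum.\<close>
  then show "backward_error N S m z P = ?e"
    unfolding backward_error_def
    by (intro Least_equality) (use x0 pair_ge in auto)
  have "z \<in> pseudospectrum N S m \<epsilon> P
      \<longleftrightarrow> (\<exists>D\<in>S. mp_norm N m D \<le> \<epsilon> \<and> (\<exists>x. norm x = 1 \<and> ?A *v x + mp_eval m D z *v x = 0))"
    by (auto simp: pseudospectrum_def spectrum_def mp_eval_add det_eq_0_iff_unit_kernel
        matrix_vector_mult_add_rdistrib)
  also have "\<dots> \<longleftrightarrow> ?e \<le> \<epsilon>"
    using ge x0 D0 D0_norm by (metis order_trans)
  finally show "z \<in> pseudospectrum N S m \<epsilon> P \<longleftrightarrow> ?e \<le> \<epsilon>" .
qed

section \<open>Distances for the two norms and the three classes\<close>

lemma spectral_norm_nonneg: "0 \<le> spectral_norm A" for A :: "complex^'n::finite^'n"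
  using spectral_norm_bound[of A "axis undefined 1"] norm_ge_zero[of "A *v axis undefined 1"]
  by (simp add: norm_axis_1 del: norm_ge_zero)

context
  fixes N :: "complex^'n::finite^'n \<Rightarrow> real"
  assumes N: "N = spectral_norm \<or> N = frobenius_norm"
begin

lemma norm_mat_scale_le: "N (mat_scale c A) \<le> cmod c * N A"
  and matrix_norm_nonneg: "0 \<le> N A"
  and matrix_norm_bound: "norm x = 1 \<Longrightarrow> norm (A *v x) \<le> N A"
  and matrix_norm_le_norm: "N A \<le> norm A"
  using N spectral_norm_mat_scale_le[of c A] frobenius_norm_mat_scale[of c A] spectral_norm_nonneg[of A] spectral_norm_bound[of A x]
    frobenius_norm_bound[of A x] spectral_norm_le_frobenius[of A]
  by (auto simp: frobenius_norm_eq_norm)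

text \<open>For a minimizing \<open>x\<close>, the rank-one matrix
  \<open>outer (- (A x)) (vcnj x)\<close> has Frobenius norm \<open>norm (A x)\<close>, which also
  bounds its spectral norm.\<close>

lemma unstructured_distance:
  fixes P :: "'n mpoly"
  assumes "P \<in> mat_polys m"
  shows "backward_error N (mat_polys m) m z P = min_gain (mp_eval m P z) / pow_norm m z"
    and "z \<in> pseudospectrum N (mat_polys m) m \<epsilon> P
      \<longleftrightarrow> min_gain (mp_eval m P z) / pow_norm m z \<le> \<epsilon>"
proof -
  let ?A = "mp_eval m P z"
  obtain x where x: "norm x = 1" "norm (?A *v x) = min_gain ?A"
    using min_gain_attained by metis
  define M where "M = outer (- (?A *v x)) (vcnj x)"
  have "M *v x = - (?A *v x)"
    using x scalar_product_self[of x] by (simp add: M_def outer_mult_vec scalar_product_commute)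
  moreover have "N M \<le> 1 * min_gain ?A"
    using matrix_norm_le_norm[of M] x by (simp add: M_def norm_outer)
  ultimately have "\<exists>x. \<exists>M\<in>UNIV. norm x = 1 \<and> M *v x = - (?A *v x) \<and> N M \<le> 1 * min_gain ?A"
    using x by blast
  note * = backward_error_and_pseudospectrum[where c = 1 and N = N, OF mat_polys_eq_class _ assms _ _
      norm_mat_scale_le matrix_norm_nonneg _ this]
  show "backward_error N (mat_polys m) m z P = min_gain (mp_eval m P z) / pow_norm m z"
    and "z \<in> pseudospectrum N (mat_polys m) m \<epsilon> P
      \<longleftrightarrow> min_gain (mp_eval m P z) / pow_norm m z \<le> \<epsilon>"
    using * by (simp_all add: matrix_norm_bound)
qed

text \<open>For a Takagi vector \<open>y\<close>, \<open>A y\<close> is a multiple of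
  \<open>vcnj y\<close>, so the optimal rank-one matrix of the unstructured case is itself
  symmetric.\<close>

lemma symmetric_distance:
  fixes P :: "'n mpoly"
  assumes P: "P \<in> sym_polys m"
  shows "backward_error N (sym_polys m) m z P = min_gain (mp_eval m P z) / pow_norm m z"
    and "z \<in> pseudospectrum N (sym_polys m) m \<epsilon> P
      \<longleftrightarrow> min_gain (mp_eval m P z) / pow_norm m z \<le> \<epsilon>"
proof -
  let ?A = "mp_eval m P z"
  let ?K = "{A :: complex^'n^'n. transpose A = A}"
  obtain x where "norm x = 1" "norm (?A *v x) = min_gain ?A"
    "\<And>y. norm y = 1 \<Longrightarrow> norm (?A *v x) \<le> norm (?A *v y)"
    using min_gain_attained by metis
  then obtain y where y: "norm y = 1" "?A *v y = complex_of_real (min_gain ?A) *s vcnj y"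
    using takagi_min_vector[OF transpose_mp_eval_sym[OF P]] by metis
  have nonneg: "0 \<le> min_gain ?A"
    using \<open>norm (?A *v x) = min_gain ?A\<close> norm_ge_zero by metis
  define M where "M = mat_scale (- complex_of_real (min_gain ?A)) (outer (vcnj y) (vcnj y))"
  have "M \<in> ?K"
    by (simp add: M_def transpose_mat_scale transpose_outer)
  moreover have "M *v y = - (?A *v y)"
    using y scalar_product_self[of y]
    by (simp add: M_def mat_scale_mult_vec outer_mult_vec scalar_product_commute)
  moreover have "norm M = min_gain ?A"
    using nonneg y
    by (simp add: M_def frobenius_norm_mat_scale norm_outer flip: frobenius_norm_eq_norm)
      (simp add: frobenius_norm_eq_norm norm_outer)
  then have "N M \<le> 1 * min_gain ?A"
    using matrix_norm_le_norm[of M] by simp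
  ultimately have "\<exists>x. \<exists>M\<in>?K. norm x = 1 \<and> M *v x = - (?A *v x) \<and> N M \<le> 1 * min_gain ?A"
    using y by blast
  note * = backward_error_and_pseudospectrum[where c = 1 and N = N, OF sym_polys_eq_class _ assms _ _
      norm_mat_scale_le matrix_norm_nonneg _ this]
  show "backward_error N (sym_polys m) m z P = min_gain (mp_eval m P z) / pow_norm m z"
    and "z \<in> pseudospectrum N (sym_polys m) m \<epsilon> P
      \<longleftrightarrow> min_gain (mp_eval m P z) / pow_norm m z \<le> \<epsilon>"
    using * by (simp_all add: matrix_norm_bound transpose_mat_scale)
qed

text \<open>The lower bound is the operator norm inequality for the spectral norm and
  \<open>skew_frobenius_norm_bound\<close> for the Frobenius norm; \<open>skew_map r x\<close> at a
  minimizing \<open>x\<close> attains either.\<close>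

lemma skew_distance:
  fixes P :: "'n mpoly"
  assumes P: "P \<in> skew_polys m"
    and c: "N = spectral_norm \<and> c = 1 \<or> N = frobenius_norm \<and> c = sqrt 2"
  shows "backward_error N (skew_polys m) m z P = c * min_gain (mp_eval m P z) / pow_norm m z"
    and "z \<in> pseudospectrum N (skew_polys m) m \<epsilon> P
      \<longleftrightarrow> c * min_gain (mp_eval m P z) / pow_norm m z \<le> \<epsilon>"
proof -
  let ?A = "mp_eval m P z"
  let ?K = "{A :: complex^'n^'n. transpose A = - A}"
  obtain x where x: "norm x = 1" "norm (?A *v x) = min_gain ?A"
    using min_gain_attained by metis
  define r where "r = - (?A *v x)"
  have r: "scalar_product r x = 0"
    using skew_scalar_product[OF transpose_mp_eval_skew[OF P]]
    by (simp add: r_def scalar_product_commute[of "- _"] scalar_product_uminus_right scalar_product_commute[of x])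
  have norm_r: "norm r = min_gain ?A"
    using x by (simp add: r_def)
  have "spectral_norm (skew_map r x) \<le> norm r"
    by (rule spectral_norm_le) (rule norm_skew_map_mult_vec[OF x(1) r])
  then have "N (skew_map r x) \<le> c * min_gain ?A"
    using c norm_skew_map[OF x(1) r] by (auto simp: norm_r frobenius_norm_eq_norm)
  moreover have "skew_map r x *v x = - (?A *v x)"
    using skew_map_apply[OF x(1) r] by (simp add: r_def)
  ultimately have "\<exists>x. \<exists>M\<in>?K. norm x = 1 \<and> M *v x = - (?A *v x) \<and> N M \<le> c * min_gain ?A"
    using x transpose_skew_map[of r x] by blast
  note * = backward_error_and_pseudospectrum[where c = c and N = N, OF skew_polys_eq_class _ assms(1) _ _
      norm_mat_scale_le matrix_norm_nonneg _ this]
  have "c * norm (A *v x) \<le> N A" if "A \<in> ?K" "norm x = 1" for A x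
    using c that skew_frobenius_norm_bound[of A x] matrix_norm_bound[of x A] by auto
  moreover have "c \<ge> 0" using c by auto
  ultimately
  show "backward_error N (skew_polys m) m z P = c * min_gain (mp_eval m P z) / pow_norm m z"
    and "z \<in> pseudospectrum N (skew_polys m) m \<epsilon> P
      \<longleftrightarrow> c * min_gain (mp_eval m P z) / pow_norm m z \<le> \<epsilon>"
    using * by (simp_all add: transpose_mat_scale mat_scale_uminus)
qed

end

section \<open>Comparison with the unstructured quantities\<close>

theorem theorem5p1:
  fixes S :: "'n::finite mpoly set" and P :: "'n mpoly"
    and m :: nat and lam :: complex and \<epsilon> :: real
  assumes "m \<ge> 1"
    and "S = sym_polys m \<or> S = skew_polys m"
    and "P \<in> S"
    and "regular_mp m P"
    and "\<epsilon> > 0"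
  shows
    "(\<not> infinity_in_pseudospectrum spectral_norm (mat_polys m) m \<epsilon> P \<longrightarrow>
        backward_error spectral_norm S m lam P = backward_error spectral_norm (mat_polys m) m lam P \<and>
        pseudospectrum spectral_norm S m \<epsilon> P = pseudospectrum spectral_norm (mat_polys m) m \<epsilon> P) \<and>
     (\<not> infinity_in_pseudospectrum frobenius_norm (mat_polys m) m \<epsilon> P \<longrightarrow>
        (S = skew_polys m \<longrightarrow>
           backward_error frobenius_norm S m lam P
             = sqrt 2 * backward_error frobenius_norm (mat_polys m) m lam P \<and>
           pseudospectrum frobenius_norm S m \<epsilon> P
             = pseudospectrum frobenius_norm (mat_polys m) m (\<epsilon> / sqrt 2) P) \<and>
        (S = sym_polys m \<longrightarrow>
           backward_error frobenius_norm S m lam P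
             = backward_error frobenius_norm (mat_polys m) m lam P \<and>
           pseudospectrum frobenius_norm S m \<epsilon> P
             = pseudospectrum frobenius_norm (mat_polys m) m \<epsilon> P))"
proof -
  have P: "P \<in> mat_polys m"
    using assms(2,3) by (auto simp: sym_polys_def skew_polys_def)
  \<comment> \<open>A factor \<open>sqrt 2\<close> in the distance amounts to shrinking the radius
    to \<open>\<epsilon> / sqrt 2\<close>.\<close>
  have sqrt2: "sqrt 2 * g / L \<le> \<epsilon> \<longleftrightarrow> g / L \<le> \<epsilon> / sqrt 2" for g L :: real
    by (simp add: le_divide_eq mult.commute)
  have "backward_error spectral_norm S m lam P = backward_error spectral_norm (mat_polys m) m lam P"
    and "pseudospectrum spectral_norm S m \<epsilon> P = pseudospectrum spectral_norm (mat_polys m) m \<epsilon> P"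
    using assms(2,3)
    by (auto simp: unstructured_distance P symmetric_distance skew_distance[where c = 1])
  moreover have "backward_error frobenius_norm S m lam P
        = sqrt 2 * backward_error frobenius_norm (mat_polys m) m lam P"
    and "pseudospectrum frobenius_norm S m \<epsilon> P
        = pseudospectrum frobenius_norm (mat_polys m) m (\<epsilon> / sqrt 2) P"
    if "S = skew_polys m"
    using assms(3) that sqrt2
    by (auto simp: unstructured_distance P skew_distance[where c = "sqrt 2"])
  moreover have "backward_error frobenius_norm S m lam P
        = backward_error frobenius_norm (mat_polys m) m lam P"
    and "pseudospectrum frobenius_norm S m \<epsilon> P
        = pseudospectrum frobenius_norm (mat_polys m) m \<epsilon> P"
    if "S = sym_polys m"
    using assms(3) that
    by (auto simp: unstructured_distance P symmetric_distance)
  ultimately show ?thesis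
    by blast
qed

end
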